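(* Let $\{u^n\}_{n=0}^N$ be the discrete DLR solution produced by the scheme described in the context with the implicit evaluation $\mathcal L(u^n,u^{n+1})=\mathcal L(u^{n+1})$ and $f^{n,n+1}=f(t_{n+1})$. Then, for any time and space discretization parameters $\triangle t,h>0$: 1. $$\|u^N\|_{H,\hat\rho}^2+\triangle t\,C_{\mathcal L}\sum_{n=0}^{N-1}\|u^{n+1}\|_{V,\hat\rho}^2\le\|u^0\|_{H,\hat\rho}^2+\triangle t\,\frac{C_P^2}{C_{\mathcal L}}\sum_{n=0}^{N-1}\|f(t_{n+1})\|_{H,\hat\rho}^2;$$ 2. if $\mathcal L$ is symmetric, $$\|u^N\|_{\mathcal L,\hat\rho}^2+\triangle t\sum_{n=0}^{N-1}\Big\|\frac{u^{n+1}-u^n}{\triangle t}\Big\|_{H,\hat\rho}^2\le\|u^0\|_{\mathcal L,\hat\rho}^2+\triangle t\sum_{n=0}^{N-1}\|f(t_{n+1})\|_{H,\hat\rho}^2.$$ In particular, for $f=0$ and $n=0,\dots,N-1$: 3. $\|u^{n+1}\|_{H,\hat\rho}\le\|u^n\|_{H,\hat\rho}$; 4. if $\mathcal L$ is symmetric, $\|u^{n+1}\|_{\mathcal L,\hat\rho}\le\|u^n\|_{\mathcal L,\hat\rho}$.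
   Context: Setting. $V,H$ are separable real Hilbert spaces forming a Gelfand triple $V\subset H\subset V'$, with $V$ dense in $H$ and $\|v\|_H\le C_P\|v\|_V$ for $v\in V$, $C_P>0$; $(\cdot,\cdot)_{V'V}$ is the duality pairing, extending $\langle\cdot,\cdot\rangle_H$. $\hat\Gamma=\{\omega_1,\dots,\omega_{\hat N}\}$ is a finite set of points with weights $\lambda_k>0$, $\sum_k\lambda_k=1$, $\hat\rho=\sum_k\lambda_k\delta_{\omega_k}$. $L^2_{\hat\rho}$ is the space of real functions on $\hat\Gamma$ with $\langle v,w\rangle_{L^2_{\hat\rho}}=\sum_k\lambda_kv(\omega_k)w(\omega_k)$; $\mathbb E_{\hat\rho}[v]=\sum_k\lambda_kv(\omega_k)$ (also for vector-valued $v$); $v^*:=v-\mathbb E_{\hat\rho}[v]$. For $X\in\{V,H\}$ and functions $\hat\Gamma\to X$: $\langle v,w\rangle_{X,\hat\rho}=\sum_k\lambda_k\langle v(\omega_k),w(\omega_k)\rangle_X$ with norm $\|\cdot\|_{X,\hat\rho}$. $L(\omega):V\to V'$ is a linear operator for each $\omega$, with constants $C_{\mathcal L},C_{\mathcal B}>0$ such that $(L(\omega)v,v)_{V'V}\ge C_{\mathcal L}\|v\|_V^2$ and $(L(\omega)v,w)_{V'V}\le C_{\mathcal B}\|v\|_V\|w\|_V$ for all $\omega$ and $v,w\in V$; $\mathcal L(u)(\omega)=L(\omega)u(\omega)$ and $\langle v,w\rangle_{\mathcal L,\hat\rho}=\sum_k\lambda_k(L(\omega_k)v(\omega_k),w(\omega_k))_{V'V}$.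 "$\mathcal L$ symmetric" means each form $(L(\omega)v,w)_{V'V}$ is symmetric in $v,w\in V$; then $\|v\|_{\mathcal L,\hat\rho}^2=\langle v,v\rangle_{\mathcal L,\hat\rho}$. $V_h\subset V$ is a finite-dimensional subspace (parameter $h>0$), $\dim V_h>R$, $R<\hat N$; $V_h\otimes L^2_{\hat\rho}$ is identified with functions $\hat\Gamma\to V_h$. $\triangle t=T/N$, $t_n=n\triangle t$. The forcing values $f(t_n):\hat\Gamma\to H$ are given. Scheme (one step, from $u^n$ to $u^{n+1}$). Given $u^n=\bar u^n+\sum_{j=1}^RU^n_jY^n_j$ with $\bar u^n,U^n_j\in V_h$, $Y^n_j\in L^2_{\hat\rho}$, $\langle Y^n_i,Y^n_j\rangle_{L^2_{\hat\rho}}=\delta_{ij}$, $\mathbb E_{\hat\rho}[Y^n_j]=0$; write $U=(U_1,\dots,U_R)$, $Y=(Y_1,\dots,Y_R)$ and $G:=\mathcal L(u^n,u^{n+1})-f^{n,n+1}$. 1. $\bar u^{n+1}\in V_h$: $\langle\frac{\bar u^{n+1}-\bar u^n}{\triangle t},v_h\rangle_H+(\mathbb E_{\hat\rho}[G],v_h)_{V'V}=0$ for all $v_h\in V_h$. 2. $\tilde U^{n+1}_j\in V_h$: $\langle\frac{\tilde U^{n+1}_j-U^n_j}{\triangle t},v_h\rangle_H+(\mathbb E_{\hat\rho}[G\,Y^n_j],v_h)_{V'V}=0$ for all $v_h\in V_h$, $j=1,\dots,R$. 3. $\tilde Y^{n+1}\in(L^2_{\hat\rho})^R$: $\frac{\tilde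 Y^{n+1}-Y^n}{\triangle t}\tilde M^{n+1}+\mathcal P^\perp_{\hat\rho,\mathcal Y^n}\big[(G^*,\tilde U^{n+1})_{V'V}\big]=0$, where $\tilde M^{n+1}_{ij}=\langle\tilde U^{n+1}_i,\tilde U^{n+1}_j\rangle_H$, $(G^*,\tilde U^{n+1})_{V'V}$ is the row $((G^*,\tilde U^{n+1}_j)_{V'V})_j$ of elements of $L^2_{\hat\rho}$, and $\mathcal P^\perp_{\hat\rho,\mathcal Y^n}$ is the $L^2_{\hat\rho}$-orthogonal projection onto the orthogonal complement of $\mathcal Y^n=\mathrm{span}\{Y^n_1,\dots,Y^n_R\}$. If $\tilde M^{n+1}$ is singular, $\tilde Y^{n+1}$ is a solution of this equation minimizing $\|\tilde Y^{n+1}-Y^n\|_{L^2_{\hat\rho}}$ (norm on $(L^2_{\hat\rho})^R$). 4. Reorthonormalize: $(U^{n+1},Y^{n+1})$ with $\sum_jY^{n+1}_jU^{n+1}_j=\sum_j\tilde Y^{n+1}_j\tilde U^{n+1}_j$, $\langle Y^{n+1}_i,Y^{n+1}_j\rangle_{L^2_{\hat\rho}}=\delta_{ij}$ (and zero-mean $Y^{n+1}_j$). 5. $u^{n+1}=\bar u^{n+1}+\sum_jU^{n+1}_jY^{n+1}_j$. Throughout, it is assumed that a discrete DLR solution exists. *)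

theory Defs
  imports "HOL-Analysis.Analysis"
begin

text \<open>
  Encoding.  The sample set is (the universe of) a finite type \<open>'w\<close>, so the elements of the
  discrete \<open>L2\<close> space are exactly the functions \<open>'w \<Rightarrow> real\<close>; \<open>lam\<close> is the family of weights.
  The index set \<open>{1, ..., R}\<close> is a finite type \<open>'r\<close>.  The Gelfand triple is given by the
  embedding \<open>\<iota> :: 'v \<Rightarrow>\<^sub>L 'h\<close> of V into H; the dual of V is \<open>'v \<Rightarrow>\<^sub>L real\<close>, and the
  duality pairing is \<^const>\<open>blinfun_apply\<close>.
\<close>

definition gelfand_triple ::
  "('v::{real_inner, complete_space} \<Rightarrow>\<^sub>L 'h::{real_inner, complete_space}) \<Rightarrow> real \<Rightarrow> bool"
  where "gelfand_triple \<iota> CP \<longleftrightarrow>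
    separable_space (euclidean :: 'v topology) \<and>
    separable_space (euclidean :: 'h topology) \<and>
    inj (blinfun_apply \<iota>) \<and> closure (range (blinfun_apply \<iota>)) = UNIV \<and>
    CP > 0 \<and> (\<forall>v. norm (\<iota> v) \<le> CP * norm v)"

text \<open>The embedding of H into the dual of V: \<open>h\<close> becomes \<open>v \<mapsto> \<langle>\<iota> v, h\<rangle>\<close>.\<close>

definition to_dual ::
  "('v::real_inner \<Rightarrow>\<^sub>L 'h::real_inner) \<Rightarrow> 'h \<Rightarrow> ('v \<Rightarrow>\<^sub>L real)"
  where "to_dual \<iota> h = blinfun_inner_left h o\<^sub>L \<iota>"

definition expect :: "('w::finite \<Rightarrow> real) \<Rightarrow> ('w \<Rightarrow> 'a::real_vector) \<Rightarrow> 'a"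
  where "expect lam v = (\<Sum>\<omega>\<in>UNIV. lam \<omega> *\<^sub>R v \<omega>)"

definition star :: "('w::finite \<Rightarrow> real) \<Rightarrow> ('w \<Rightarrow> 'a::real_vector) \<Rightarrow> 'w \<Rightarrow> 'a"
  where "star lam v = (\<lambda>\<omega>. v \<omega> - expect lam v)"

text \<open>For \<open>'a = real\<close> these are the inner product and norm of the scalar discrete \<open>L2\<close> space.\<close>

definition inner_rho ::
  "('w::finite \<Rightarrow> real) \<Rightarrow> ('w \<Rightarrow> 'a::real_inner) \<Rightarrow> ('w \<Rightarrow> 'a) \<Rightarrow> real"
  where "inner_rho lam v w = (\<Sum>\<omega>\<in>UNIV. lam \<omega> * (v \<omega> \<bullet> w \<omega>))"

definition norm_rho :: "('w::finite \<Rightarrow> real) \<Rightarrow> ('w \<Rightarrow> 'a::real_inner) \<Rightarrow> real"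
  where "norm_rho lam v = sqrt (inner_rho lam v v)"

definition norm_rho_H ::
  "('v::real_inner \<Rightarrow>\<^sub>L 'h::real_inner) \<Rightarrow> ('w::finite \<Rightarrow> real) \<Rightarrow> ('w \<Rightarrow> 'v) \<Rightarrow> real"
  where "norm_rho_H \<iota> lam v = norm_rho lam (\<lambda>\<omega>. \<iota> (v \<omega>))"

definition elliptic_operator ::
  "('w::finite \<Rightarrow> 'v::real_inner \<Rightarrow> ('v \<Rightarrow>\<^sub>L real)) \<Rightarrow> real \<Rightarrow> real \<Rightarrow> bool"
  where "elliptic_operator L CL CB \<longleftrightarrow>
    (\<forall>\<omega>. linear (L \<omega>)) \<and> CL > 0 \<and> CB > 0 \<and>
    (\<forall>\<omega> v. blinfun_apply (L \<omega> v) v \<ge> CL * (norm v)\<^sup>2) \<and>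
    (\<forall>\<omega> v w. blinfun_apply (L \<omega> v) w \<le> CB * norm v * norm w)"

definition symmetric_operator ::
  "('w::finite \<Rightarrow> 'v::real_inner \<Rightarrow> ('v \<Rightarrow>\<^sub>L real)) \<Rightarrow> bool"
  where "symmetric_operator L \<longleftrightarrow>
    (\<forall>\<omega> v w. blinfun_apply (L \<omega> v) w = blinfun_apply (L \<omega> w) v)"

definition inner_L ::
  "('w::finite \<Rightarrow> real) \<Rightarrow> ('w \<Rightarrow> 'v::real_inner \<Rightarrow> ('v \<Rightarrow>\<^sub>L real)) \<Rightarrow>
    ('w \<Rightarrow> 'v) \<Rightarrow> ('w \<Rightarrow> 'v) \<Rightarrow> real"
  where "inner_L lam L v w = (\<Sum>\<omega>\<in>UNIV. lam \<omega> * blinfun_apply (L \<omega> (v \<omega>)) (w \<omega>))"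

definition norm_L ::
  "('w::finite \<Rightarrow> real) \<Rightarrow> ('w \<Rightarrow> 'v::real_inner \<Rightarrow> ('v \<Rightarrow>\<^sub>L real)) \<Rightarrow> ('w \<Rightarrow> 'v) \<Rightarrow> real"
  where "norm_L lam L v = sqrt (inner_L lam L v v)"

definition span_L2 :: "('r::finite \<Rightarrow> 'w \<Rightarrow> real) \<Rightarrow> ('w \<Rightarrow> real) set"
  where "span_L2 Y = range (\<lambda>c \<omega>. \<Sum>j\<in>UNIV. c j * Y j \<omega>)"

definition orth_compl :: "('w::finite \<Rightarrow> real) \<Rightarrow> ('w \<Rightarrow> real) set \<Rightarrow> ('w \<Rightarrow> real) set"
  where "orth_compl lam S = {w. \<forall>v\<in>S. inner_rho lam v w = 0}"

definition orth_proj ::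
  "('w::finite \<Rightarrow> real) \<Rightarrow> ('w \<Rightarrow> real) set \<Rightarrow> ('w \<Rightarrow> real) \<Rightarrow> 'w \<Rightarrow> real"
  where "orth_proj lam W v =
    (THE p. p \<in> W \<and> (\<forall>w\<in>W. inner_rho lam (\<lambda>\<omega>. v \<omega> - p \<omega>) w = 0))"

definition proj_perp ::
  "('w::finite \<Rightarrow> real) \<Rightarrow> ('r::finite \<Rightarrow> 'w \<Rightarrow> real) \<Rightarrow> ('w \<Rightarrow> real) \<Rightarrow> 'w \<Rightarrow> real"
  where "proj_perp lam Y = orth_proj lam (orth_compl lam (span_L2 Y))"

definition norm_L2R :: "('w::finite \<Rightarrow> real) \<Rightarrow> ('r::finite \<Rightarrow> 'w \<Rightarrow> real) \<Rightarrow> real"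
  where "norm_L2R lam Z = sqrt (\<Sum>j\<in>UNIV. (norm_rho lam (Z j))\<^sup>2)"

definition gram ::
  "('v::real_inner \<Rightarrow>\<^sub>L 'h::real_inner) \<Rightarrow> ('r::finite \<Rightarrow> 'v) \<Rightarrow> real^'r^'r"
  where "gram \<iota> U = (\<chi> i j. \<iota> (U i) \<bullet> \<iota> (U j))"

definition low_rank_sum ::
  "('r::finite \<Rightarrow> 'v::real_vector) \<Rightarrow> ('r \<Rightarrow> 'w \<Rightarrow> real) \<Rightarrow> 'w \<Rightarrow> 'v"
  where "low_rank_sum U Y = (\<lambda>\<omega>. \<Sum>j\<in>UNIV. Y j \<omega> *\<^sub>R U j)"

definition dlr_factors ::
  "('w::finite \<Rightarrow> real) \<Rightarrow> 'v::real_inner set \<Rightarrow>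
    'v \<Rightarrow> ('r::finite \<Rightarrow> 'v) \<Rightarrow> ('r \<Rightarrow> 'w \<Rightarrow> real) \<Rightarrow> bool"
  where "dlr_factors lam Vh ub U Y \<longleftrightarrow>
    ub \<in> Vh \<and> (\<forall>j. U j \<in> Vh) \<and>
    (\<forall>i j. inner_rho lam (Y i) (Y j) = (if i = j then 1 else 0)) \<and>
    (\<forall>j. expect lam (Y j) = 0)"

text \<open>
  The scheme is stated for an arbitrary \<open>G\<close> (the value of the operator minus the forcing), which
  in the implicit case depends on the new iterate.  In the stochastic equation \<open>G\<close> and the
  predicted modes \<open>Ut\<close> are held fixed, so the equation is linear in \<open>Yt\<close>; the minimality
  condition below is over all solutions of this linear equation.
\<close>

definition stochastic_eq ::
  "('v::real_inner \<Rightarrow>\<^sub>L 'h::real_inner) \<Rightarrow> ('w::finite \<Rightarrow> real) \<Rightarrow> real \<Rightarrow> ('w \<Rightarrow> ('v \<Rightarrow>\<^sub>L real)) \<Rightarrow>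
    ('r::finite \<Rightarrow> 'w \<Rightarrow> real) \<Rightarrow> ('r \<Rightarrow> 'v) \<Rightarrow> ('r \<Rightarrow> 'w \<Rightarrow> real) \<Rightarrow> bool"
  where "stochastic_eq \<iota> lam dt G Y Ut Yt \<longleftrightarrow>
    (\<forall>j \<omega>. (\<Sum>i\<in>UNIV. (Yt i \<omega> - Y i \<omega>) / dt * gram \<iota> Ut $ i $ j)
        + proj_perp lam Y (\<lambda>\<xi>. blinfun_apply (star lam G \<xi>) (Ut j)) \<omega> = 0)"

definition dlr_step ::
  "('v::real_inner \<Rightarrow>\<^sub>L 'h::real_inner) \<Rightarrow> ('w::finite \<Rightarrow> real) \<Rightarrow> 'v set \<Rightarrow> real \<Rightarrow>
    ('w \<Rightarrow> ('v \<Rightarrow>\<^sub>L real)) \<Rightarrow>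
    'v \<Rightarrow> ('r::finite \<Rightarrow> 'v) \<Rightarrow> ('r \<Rightarrow> 'w \<Rightarrow> real) \<Rightarrow>
    'v \<Rightarrow> ('r \<Rightarrow> 'v) \<Rightarrow> ('r \<Rightarrow> 'w \<Rightarrow> real) \<Rightarrow> bool"
  where "dlr_step \<iota> lam Vh dt G ub U Y ub' U' Y' \<longleftrightarrow>
    dlr_factors lam Vh ub U Y \<and> dlr_factors lam Vh ub' U' Y' \<and>
    (\<forall>vh\<in>Vh. \<iota> ((ub' - ub) /\<^sub>R dt) \<bullet> \<iota> vh + blinfun_apply (expect lam G) vh = 0) \<and>
    (\<exists>Ut Yt.
      (\<forall>j. Ut j \<in> Vh) \<and>
      (\<forall>j. \<forall>vh\<in>Vh. \<iota> ((Ut j - U j) /\<^sub>R dt) \<bullet> \<iota> vh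
          + blinfun_apply (expect lam (\<lambda>\<omega>. Y j \<omega> *\<^sub>R G \<omega>)) vh = 0) \<and>
      stochastic_eq \<iota> lam dt G Y Ut Yt \<and>
      (\<not> invertible (gram \<iota> Ut) \<longrightarrow>
        (\<forall>Z. stochastic_eq \<iota> lam dt G Y Ut Z \<longrightarrow>
          norm_L2R lam (\<lambda>j \<omega>. Yt j \<omega> - Y j \<omega>) \<le> norm_L2R lam (\<lambda>j \<omega>. Z j \<omega> - Y j \<omega>))) \<and>
      low_rank_sum U' Y' = low_rank_sum Ut Yt)"

text \<open>
  \<open>G\<close> at step \<open>n\<close> uses the full new iterate \<open>u (n+1)\<close>, so the equations of one step are coupled.
\<close>

definition implicit_dlr_solution ::
  "('v::real_inner \<Rightarrow>\<^sub>L 'h::real_inner) \<Rightarrow> ('w::finite \<Rightarrow> real) \<Rightarrow>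
    ('w \<Rightarrow> 'v \<Rightarrow> ('v \<Rightarrow>\<^sub>L real)) \<Rightarrow> 'v set \<Rightarrow> (real \<Rightarrow> 'w \<Rightarrow> 'h) \<Rightarrow> real \<Rightarrow> nat \<Rightarrow>
    (nat \<Rightarrow> 'v) \<Rightarrow> (nat \<Rightarrow> 'r::finite \<Rightarrow> 'v) \<Rightarrow> (nat \<Rightarrow> 'r \<Rightarrow> 'w \<Rightarrow> real) \<Rightarrow>
    (nat \<Rightarrow> 'w \<Rightarrow> 'v) \<Rightarrow> bool"
  where "implicit_dlr_solution \<iota> lam L Vh f dt N ub U Y u \<longleftrightarrow>
    (\<forall>n\<le>N. u n = (\<lambda>\<omega>. ub n + low_rank_sum (U n) (Y n) \<omega>)) \<and>
    (\<forall>n<N. dlr_step \<iota> lam Vh dt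
      (\<lambda>\<omega>. L \<omega> (u (n+1) \<omega>) - to_dual \<iota> (f (real (n+1) * dt) \<omega>))
      (ub n) (U n) (Y n) (ub (n+1)) (U (n+1)) (Y (n+1)))"

end

theory Submission
  imports Defs
begin

text \<open>
  Writing the new iterate with the predicted factors, the increment is
  \<open>(ub' - ub) + (\<Sum>j. Y j (Ut j - U j)) + dt D\<close> with \<open>D = (\<Sum>j. (Yt j - Y j) / dt * Ut j)\<close>.
  The stochastic equation says that \<open>D\<close>, tested against the modes \<open>Ut j\<close> in H, lies in the
  orthogonal complement of the span of \<open>1\<close> and the \<open>Y j\<close>; since \<open>D\<close> takes values in
  the span of the \<open>Ut j\<close>, its moments against \<open>1\<close> and the \<open>Y j\<close> vanish.  The argument is
  about \<open>D\<close> and not about its coefficients, so it covers a singular Gram matrix.  Hence the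
  scheme is a Galerkin identity for all test functions \<open>c + (\<Sum>j. Y j V j) + s D\<close> with \<open>c\<close> and
  the \<open>V j\<close> in the finite element space.  Both the new iterate and the increment are of this
  form, and testing with them gives the two energy estimates.
\<close>

section \<open>Calculus of the weighted expectation\<close>

lemma expect_linear:
  assumes "linear F"
  shows "F (expect lam v) = expect lam (\<lambda>\<omega>. F (v \<omega>))"
  using assms by (simp add: expect_def linear_sum linear_scale)

lemma expect_add: "expect lam (\<lambda>\<omega>. v \<omega> + w \<omega>) = expect lam v + expect lam w"
  by (simp add: expect_def scaleR_add_right sum.distrib)

lemma expect_diff: "expect lam (\<lambda>\<omega>. v \<omega> - w \<omega>) = expect lam v - expect lam w"
  by (simp add: expect_def scaleR_diff_right sum_subtractf)

lemma expect_scaleR: "expect lam (\<lambda>\<omega>. c *\<^sub>R v \<omega>) = c *\<^sub>R expect lam v"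
  by (simp add: expect_def scaleR_sum_right mult.commute)

lemma expect_mult_left: "expect lam (\<lambda>\<omega>. c * v \<omega>) = c * expect lam v" for c :: real
  using expect_scaleR[of lam c v] by simp

lemma expect_scaleR_const: "expect lam (\<lambda>\<omega>. g \<omega> *\<^sub>R c) = expect lam g *\<^sub>R c"
  by (simp add: expect_def scaleR_sum_left)

lemma expect_sum: "expect lam (\<lambda>\<omega>. \<Sum>j\<in>A. v j \<omega>) = (\<Sum>j\<in>A. expect lam (v j))"
  unfolding expect_def scaleR_sum_right by (rule sum.swap)

lemma expect_const:
  assumes "(\<Sum>\<omega>\<in>UNIV. lam \<omega>) = 1"
  shows "expect lam (\<lambda>\<omega>. c) = c"
  using assms by (simp add: expect_def flip: scaleR_sum_left)

lemma expect_mono: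
  assumes "\<And>\<omega>. lam \<omega> > 0" "\<And>\<omega>. v \<omega> \<le> w \<omega>"
  shows "expect lam v \<le> expect lam (w :: _ \<Rightarrow> real)"
  unfolding expect_def using assms by (intro sum_mono) (simp add: less_imp_le)

lemma expect_blinfun_left:
  "blinfun_apply (expect lam G) x = expect lam (\<lambda>\<omega>. blinfun_apply (G \<omega>) x)"
  by (rule expect_linear) (simp add: linear_iff blinfun.bilinear_simps)

lemma expect_blinfun_right:
  "blinfun_apply A (expect lam v) = expect lam (\<lambda>\<omega>. blinfun_apply A (v \<omega>))"
  by (rule expect_linear) (simp add: linear_iff blinfun.bilinear_simps)

lemma expect_inner_left: "expect lam v \<bullet> x = expect lam (\<lambda>\<omega>. v \<omega> \<bullet> x)"
  by (rule expect_linear[of "\<lambda>y. y \<bullet> x"]) (simp add: linear_iff inner_simps)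

section \<open>Discrete inner products and norms as expectations\<close>

lemma inner_rho_eq_expect: "inner_rho lam v w = expect lam (\<lambda>\<omega>. v \<omega> \<bullet> w \<omega>)"
  by (simp add: inner_rho_def expect_def)

lemma inner_L_eq_expect:
  "inner_L lam L v w = expect lam (\<lambda>\<omega>. blinfun_apply (L \<omega> (v \<omega>)) (w \<omega>))"
  by (simp add: inner_L_def expect_def)

lemma inner_rho_nonneg:
  assumes "\<And>\<omega>. lam \<omega> > 0"
  shows "inner_rho lam v v \<ge> 0"
  unfolding inner_rho_def using assms by (intro sum_nonneg) (simp add: less_imp_le)

lemma inner_rho_eq_0_iff:
  assumes "\<And>\<omega>. lam \<omega> > 0"
  shows "inner_rho lam v v = 0 \<longleftrightarrow> (\<forall>\<omega>. v \<omega> = 0)"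
proof -
  have "inner_rho lam v v = 0 \<longleftrightarrow> (\<forall>\<omega>\<in>UNIV. lam \<omega> * (v \<omega> \<bullet> v \<omega>) = 0)"
    unfolding inner_rho_def using assms
    by (intro sum_nonneg_eq_0_iff) (simp_all add: less_imp_le)
  moreover have "lam \<omega> \<noteq> 0" for \<omega>
    using assms[of \<omega>] by simp
  ultimately show ?thesis by simp
qed

lemma norm_rho_square:
  assumes "\<And>\<omega>. lam \<omega> > 0"
  shows "(norm_rho lam v)\<^sup>2 = expect lam (\<lambda>\<omega>. (norm (v \<omega>))\<^sup>2)"
  using inner_rho_nonneg[of lam v, OF assms]
  by (simp add: norm_rho_def inner_rho_eq_expect dot_square_norm)

lemma elliptic_operator_nonneg:
  assumes "elliptic_operator L CL CB"
  shows "blinfun_apply (L \<omega> v) v \<ge> 0"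
  using assms unfolding elliptic_operator_def
  by (meson less_imp_le mult_nonneg_nonneg order_trans zero_le_power2)

lemma inner_L_nonneg:
  assumes "\<And>\<omega>. lam \<omega> > 0" "elliptic_operator L CL CB"
  shows "inner_L lam L v v \<ge> 0"
  unfolding inner_L_def using assms
  by (intro sum_nonneg) (simp add: less_imp_le elliptic_operator_nonneg)

lemma norm_L_square:
  assumes "\<And>\<omega>. lam \<omega> > 0" "elliptic_operator L CL CB"
  shows "(norm_L lam L v)\<^sup>2 = expect lam (\<lambda>\<omega>. blinfun_apply (L \<omega> (v \<omega>)) (v \<omega>))"
  using inner_L_nonneg[of lam, OF assms, of v] by (simp add: norm_L_def inner_L_eq_expect)

section \<open>The orthogonal projection and the stochastic increment\<close>

text \<open>\<open>orth_proj\<close> is a definite description, so it carries information only once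
  existence and uniqueness are known. Subtracting the Fourier part of \<open>g\<close> gives an
  element with the defining property; positive weights make the inner product definite, which gives
  uniqueness.\<close>

lemma proj_perp_orthonormal:
  fixes Y :: "'r::finite \<Rightarrow> 'w::finite \<Rightarrow> real"
  assumes pos: "\<And>\<omega>. lam \<omega> > 0"
    and on: "\<And>i j. inner_rho lam (Y i) (Y j) = (if i = j then 1 else 0)"
  shows "proj_perp lam Y g = (\<lambda>\<omega>. g \<omega> - (\<Sum>k\<in>UNIV. inner_rho lam (Y k) g * Y k \<omega>))"
proof -
  define q where "q = (\<lambda>\<omega>. g \<omega> - (\<Sum>k\<in>UNIV. inner_rho lam (Y k) g * Y k \<omega>))"
  define W where "W = orth_compl lam (span_L2 Y)"
  have span_left: "inner_rho lam (\<lambda>\<omega>. \<Sum>j\<in>UNIV. c j * Y j \<omega>) v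
      = (\<Sum>j\<in>UNIV. c j * inner_rho lam (Y j) v)" for c v
    by (simp add: inner_rho_eq_expect sum_distrib_right expect_sum mult.assoc expect_mult_left)
  have W_iff: "v \<in> W \<longleftrightarrow> (\<forall>j. inner_rho lam (Y j) v = 0)" for v
  proof
    assume v: "v \<in> W"
    show "\<forall>j. inner_rho lam (Y j) v = 0"
    proof
      fix j
      have "Y j = (\<lambda>\<omega>. \<Sum>i\<in>UNIV. (if i = j then 1 else 0) * Y i \<omega>)"
        by (simp add: if_distrib[of "\<lambda>x. x * _"] cong: if_cong)
      then have "Y j \<in> span_L2 Y"
        unfolding span_L2_def by (rule range_eqI[of _ _ "\<lambda>i. if i = j then 1 else 0"])
      with v show "inner_rho lam (Y j) v = 0"
        by (simp add: W_def orth_compl_def)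
    qed
  qed (auto simp: W_def orth_compl_def span_L2_def span_left)
  have inner_diff: "inner_rho lam v (\<lambda>\<omega>. a \<omega> - b \<omega>) = inner_rho lam v a - inner_rho lam v b"
    "inner_rho lam (\<lambda>\<omega>. a \<omega> - b \<omega>) v = inner_rho lam a v - inner_rho lam b v"
    for v a b :: "'w \<Rightarrow> real"
    by (simp_all add: inner_rho_eq_expect right_diff_distrib left_diff_distrib expect_diff)
  have comm: "inner_rho lam a b = inner_rho lam b a" for a b :: "'w \<Rightarrow> real"
    by (simp add: inner_rho_def mult.commute)
  have qW: "q \<in> W"
    unfolding W_iff
  proof
    fix j
    have "inner_rho lam (Y j) q
        = inner_rho lam (Y j) g - (\<Sum>k\<in>UNIV. inner_rho lam (Y k) g * inner_rho lam (Y k) (Y j))"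
      unfolding q_def inner_diff by (subst comm) (simp add: span_left comm)
    also have "\<dots> = 0"
      by (simp add: on if_distrib[of "\<lambda>x. _ * x"] cong: if_cong)
    finally show "inner_rho lam (Y j) q = 0" .
  qed
  have qorth: "inner_rho lam (\<lambda>\<omega>. g \<omega> - q \<omega>) w = 0" if "w \<in> W" for w
    using that by (simp add: q_def span_left W_iff)
  have "proj_perp lam Y g = q"
    unfolding proj_perp_def orth_proj_def W_def[symmetric]
  proof (rule the_equality)
    show "q \<in> W \<and> (\<forall>w\<in>W. inner_rho lam (\<lambda>\<omega>. g \<omega> - q \<omega>) w = 0)"
      using qW qorth by blast
  next
    fix p
    assume p: "p \<in> W \<and> (\<forall>w\<in>W. inner_rho lam (\<lambda>\<omega>. g \<omega> - p \<omega>) w = 0)"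
    \<comment> \<open>The difference of two candidates lies in \<open>W\<close> and is orthogonal to
      \<open>W\<close>, hence to itself.\<close>
    define d where "d = (\<lambda>\<omega>. p \<omega> - q \<omega>)"
    have dW: "d \<in> W"
      using p qW by (simp add: W_iff d_def inner_diff)
    have "inner_rho lam d d = inner_rho lam (\<lambda>\<omega>. g \<omega> - q \<omega>) d - inner_rho lam (\<lambda>\<omega>. g \<omega> - p \<omega>) d"
      by (simp add: d_def inner_diff)
    also have "\<dots> = 0"
      using p dW qorth by simp
    finally show "p = q"
      using inner_rho_eq_0_iff[of lam d, OF pos] by (simp add: d_def fun_eq_iff)
  qed
  then show ?thesis
    by (simp add: q_def)
qed

text \<open>Orthogonality to the generators passes to the combination itself, so its H-norm is 0,
  and injectivity of \<open>\<iota>\<close> brings this back to V. The conclusion concerns the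
  combination and not its coefficients \<open>c\<close>, so linearly dependent \<open>X j\<close>
  are allowed.\<close>

lemma combination_eq_0:
  assumes "inj (blinfun_apply \<iota>)"
    and "\<And>j. \<iota> (\<Sum>i\<in>UNIV. c i *\<^sub>R X i) \<bullet> \<iota> (X j) = 0"
  shows "(\<Sum>i\<in>UNIV. c i *\<^sub>R X i) = 0"
proof -
  let ?x = "\<Sum>i\<in>UNIV. c i *\<^sub>R X i"
  have "\<iota> ?x \<bullet> \<iota> ?x = (\<Sum>j\<in>UNIV. c j * (\<iota> ?x \<bullet> \<iota> (X j)))"
    by (subst (2) blinfun.sum_right) (simp add: inner_sum_right blinfun.scaleR_right)
  also have "\<dots> = 0"
    using assms(2) by simp
  finally have "\<iota> ?x = \<iota> 0"
    by (simp add: blinfun.zero_right)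
  with assms(1) show ?thesis
    by (rule injD)
qed

text \<open>These are the three facts through which the stochastic equation enters the Galerkin
  identity. The moments vanish because the H-pairings of \<open>D\<close> with the
  \<open>Ut j\<close> are, up to sign, projections of zero-mean data onto the complement of the
  \<open>Y k\<close>. The energy identity comes from testing with \<open>D\<close> itself: what
  projection and centring subtract from \<open>G\<close> meets only vanishing moments.\<close>

lemma stochastic_increment:
  fixes \<iota> :: "'v::real_inner \<Rightarrow>\<^sub>L 'h::real_inner"
    and lam :: "'w::finite \<Rightarrow> real" and Y Yt :: "'r::finite \<Rightarrow> 'w \<Rightarrow> real"
  assumes inj: "inj (blinfun_apply \<iota>)"
    and pos: "\<And>\<omega>. lam \<omega> > 0" and sum1: "(\<Sum>\<omega>\<in>UNIV. lam \<omega>) = 1"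
    and on: "\<And>i j. inner_rho lam (Y i) (Y j) = (if i = j then 1 else 0)"
    and mean: "\<And>j. expect lam (Y j) = 0"
    and eq: "stochastic_eq \<iota> lam dt G Y Ut Yt"
    and D: "D = low_rank_sum Ut (\<lambda>j \<omega>. (Yt j \<omega> - Y j \<omega>) / dt)"
  shows "expect lam D = 0"
    and "expect lam (\<lambda>\<omega>. Y k \<omega> *\<^sub>R D \<omega>) = 0"
    and "expect lam (\<lambda>\<omega>. \<iota> (D \<omega>) \<bullet> \<iota> (D \<omega>)) + expect lam (\<lambda>\<omega>. blinfun_apply (G \<omega>) (D \<omega>)) = 0"
proof -
  define \<delta> where "\<delta> j \<omega> = (Yt j \<omega> - Y j \<omega>) / dt" for j \<omega>
  define g where "g j \<omega> = blinfun_apply (star lam G \<omega>) (Ut j)" for j \<omega>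
  have D': "D = (\<lambda>\<omega>. \<Sum>j\<in>UNIV. \<delta> j \<omega> *\<^sub>R Ut j)"
    by (simp add: D low_rank_sum_def \<delta>_def)
  \<comment> \<open>Contracting the difference quotients \<open>\<delta> i\<close> with the Gram
    matrix is pairing \<open>D\<close> with \<open>Ut j\<close> in H, so the stochastic equation
    prescribes exactly these pairings.\<close>
  have p: "\<iota> (D \<omega>) \<bullet> \<iota> (Ut j) = - (g j \<omega> - (\<Sum>k\<in>UNIV. inner_rho lam (Y k) (g j) * Y k \<omega>))"
    for j \<omega>
  proof -
    have "\<iota> (D \<omega>) \<bullet> \<iota> (Ut j) = (\<Sum>i\<in>UNIV. \<delta> i \<omega> * gram \<iota> Ut $ i $ j)"
      by (simp add: D' gram_def blinfun.bilinear_simps blinfun.sum_right inner_sum_left)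
    also have "\<dots> = - proj_perp lam Y (g j) \<omega>"
      using eq by (simp add: stochastic_eq_def \<delta>_def g_def[abs_def] add_eq_0_iff)
    finally show ?thesis
      by (simp add: proj_perp_orthonormal[OF pos on])
  qed
  have gmean: "expect lam (g j) = 0" for j
    by (simp add: g_def[abs_def] star_def blinfun.diff_left expect_diff expect_const[OF sum1]
        expect_blinfun_left)
  \<comment> \<open>A moment of \<open>D\<close> is a combination of the \<open>Ut i\<close>, and
    its H-pairings with them are scalar moments of the pairings in \<open>p\<close>;
    \<open>combination_eq_0\<close> then applies without inverting the Gram matrix.\<close>
  have moment: "expect lam (\<lambda>\<omega>. y \<omega> *\<^sub>R D \<omega>) = 0"
    if y: "\<And>j. expect lam (\<lambda>\<omega>. y \<omega> * (\<iota> (D \<omega>) \<bullet> \<iota> (Ut j))) = 0" for y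
  proof -
    have eqs: "expect lam (\<lambda>\<omega>. y \<omega> *\<^sub>R D \<omega>) = (\<Sum>i\<in>UNIV. expect lam (\<lambda>\<omega>. y \<omega> * \<delta> i \<omega>) *\<^sub>R Ut i)"
      by (simp add: D' scaleR_sum_right expect_sum expect_scaleR_const)
    have "\<iota> (expect lam (\<lambda>\<omega>. y \<omega> *\<^sub>R D \<omega>)) \<bullet> \<iota> (Ut j) = 0" for j
      using y by (simp add: expect_blinfun_right expect_inner_left blinfun.scaleR_right)
    then show ?thesis
      unfolding eqs by (intro combination_eq_0[OF inj])
  qed
  \<comment> \<open>With \<open>y = 1\<close>: \<open>g j\<close> has zero mean by centring, and so
    do the \<open>Y k\<close> that the projection subtracts.\<close>
  show mean_D: "expect lam D = 0"
    using moment[of "\<lambda>_. 1"]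
    by (simp add: p expect_diff expect_sum expect_mult_left mean gmean)
  show mom_D: "expect lam (\<lambda>\<omega>. Y k \<omega> *\<^sub>R D \<omega>) = 0" for k
  proof (rule moment)
    fix j
    \<comment> \<open>Orthonormality collapses the sum to the very coefficient that is subtracted
      from it.\<close>
    have "expect lam (\<lambda>\<omega>. Y k \<omega> * (\<iota> (D \<omega>) \<bullet> \<iota> (Ut j)))
        = (\<Sum>i\<in>UNIV. inner_rho lam (Y i) (g j) * inner_rho lam (Y k) (Y i)) - inner_rho lam (Y k) (g j)"
      by (simp add: p right_diff_distrib expect_diff sum_distrib_left expect_sum
          mult.left_commute[of "Y k _"] expect_mult_left inner_rho_eq_expect)
    also have "\<dots> = 0"
      by (simp add: on if_distrib[of "\<lambda>x. _ * x"] cong: if_cong)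
    finally show "expect lam (\<lambda>\<omega>. Y k \<omega> * (\<iota> (D \<omega>) \<bullet> \<iota> (Ut j))) = 0" .
  qed
  \<comment> \<open>\<open>c k\<close> is the Fourier coefficient of the centred \<open>G\<close>
    against \<open>Y k\<close>, kept as a functional on V. By linearity, weighting its values at the
    \<open>Ut j\<close> with \<open>\<delta> j \<omega>\<close> and summing over \<open>j\<close>
    gives its value at \<open>D \<omega>\<close>.\<close>
  define c where "c k = expect lam (\<lambda>\<omega>. Y k \<omega> *\<^sub>R star lam G \<omega>)" for k
  have c: "inner_rho lam (Y k) (g j) = blinfun_apply (c k) (Ut j)" for k j
    by (simp add: c_def g_def inner_rho_eq_expect expect_blinfun_left blinfun.scaleR_left)
  have "\<iota> (D \<omega>) \<bullet> \<iota> (D \<omega>) = (\<Sum>k\<in>UNIV. blinfun_apply (c k) (Y k \<omega> *\<^sub>R D \<omega>))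
      - (blinfun_apply (G \<omega>) (D \<omega>) - blinfun_apply (expect lam G) (D \<omega>))" for \<omega>
  proof -
    have "\<iota> (D \<omega>) \<bullet> \<iota> (D \<omega>) = (\<Sum>j\<in>UNIV. \<delta> j \<omega> * (\<iota> (D \<omega>) \<bullet> \<iota> (Ut j)))"
      by (subst (2) fun_cong[OF D'])
        (simp add: blinfun.sum_right inner_sum_right blinfun.scaleR_right)
    also have "\<dots> = (\<Sum>j\<in>UNIV. \<Sum>k\<in>UNIV. \<delta> j \<omega> * (blinfun_apply (c k) (Ut j) * Y k \<omega>))
        - (\<Sum>j\<in>UNIV. \<delta> j \<omega> * g j \<omega>)"
      by (simp add: p c right_diff_distrib sum_subtractf sum_distrib_left)
    also have "(\<Sum>j\<in>UNIV. \<Sum>k\<in>UNIV. \<delta> j \<omega> * (blinfun_apply (c k) (Ut j) * Y k \<omega>))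
        = (\<Sum>k\<in>UNIV. blinfun_apply (c k) (Y k \<omega> *\<^sub>R D \<omega>))"
      by (subst sum.swap)
        (simp add: D' blinfun.scaleR_right blinfun.sum_right sum_distrib_left mult_ac)
    also have "(\<Sum>j\<in>UNIV. \<delta> j \<omega> * g j \<omega>)
        = blinfun_apply (G \<omega>) (D \<omega>) - blinfun_apply (expect lam G) (D \<omega>)"
      by (simp add: D' g_def star_def blinfun.scaleR_right blinfun.sum_right blinfun.diff_left
          right_diff_distrib sum_subtractf)
    finally show ?thesis .
  qed
  \<comment> \<open>The expectation moves inside the fixed functionals \<open>c k\<close> and
    \<open>expect lam G\<close>, where it meets the vanishing moments of \<open>D\<close>.\<close>
  then have "expect lam (\<lambda>\<omega>. \<iota> (D \<omega>) \<bullet> \<iota> (D \<omega>))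
      = (\<Sum>k\<in>UNIV. blinfun_apply (c k) (expect lam (\<lambda>\<omega>. Y k \<omega> *\<^sub>R D \<omega>)))
      - (expect lam (\<lambda>\<omega>. blinfun_apply (G \<omega>) (D \<omega>)) - blinfun_apply (expect lam G) (expect lam D))"
    by (simp add: expect_diff expect_sum expect_blinfun_right)
  then show "expect lam (\<lambda>\<omega>. \<iota> (D \<omega>) \<bullet> \<iota> (D \<omega>)) + expect lam (\<lambda>\<omega>. blinfun_apply (G \<omega>) (D \<omega>)) = 0"
    by (simp add: mean_D mom_D blinfun.zero_right)
qed

section \<open>The Galerkin identity of one step\<close>

text \<open>Both choices of \<open>w\<close> contain \<open>D\<close> with the same factor
  \<open>dt\<close>, so one inner statement with free \<open>c\<close> and \<open>V\<close> in
  \<open>Vh\<close> covers them.\<close>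

lemma dlr_step_galerkin:
  fixes \<iota> :: "'v::real_inner \<Rightarrow>\<^sub>L 'h::real_inner"
    and lam :: "'w::finite \<Rightarrow> real" and Y Y' :: "'r::finite \<Rightarrow> 'w \<Rightarrow> real"
  assumes inj: "inj (blinfun_apply \<iota>)"
    and pos: "\<And>\<omega>. lam \<omega> > 0" and sum1: "(\<Sum>\<omega>\<in>UNIV. lam \<omega>) = 1"
    and dt: "dt > 0" and sub: "subspace Vh"
    and step: "dlr_step \<iota> lam Vh dt G ub U Y ub' U' Y'"
    and u: "u = (\<lambda>\<omega>. ub + low_rank_sum U Y \<omega>)"
    and u': "u' = (\<lambda>\<omega>. ub' + low_rank_sum U' Y' \<omega>)"
    and w: "w = u' \<or> w = (\<lambda>\<omega>. u' \<omega> - u \<omega>)"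
  shows "expect lam (\<lambda>\<omega>. \<iota> (u' \<omega> - u \<omega>) \<bullet> \<iota> (w \<omega>))
    + dt * expect lam (\<lambda>\<omega>. blinfun_apply (G \<omega>) (w \<omega>)) = 0"
proof -
  from step obtain Ut Yt where
    mean_eq: "\<And>v. v \<in> Vh \<Longrightarrow> \<iota> ((ub' - ub) /\<^sub>R dt) \<bullet> \<iota> v + blinfun_apply (expect lam G) v = 0"
    and Ut: "\<And>j. Ut j \<in> Vh"
    and mode_eq: "\<And>j v. v \<in> Vh \<Longrightarrow> \<iota> ((Ut j - U j) /\<^sub>R dt) \<bullet> \<iota> v
        + blinfun_apply (expect lam (\<lambda>\<omega>. Y j \<omega> *\<^sub>R G \<omega>)) v = 0"
    and stoch: "stochastic_eq \<iota> lam dt G Y Ut Yt"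
    and reorth: "low_rank_sum U' Y' = low_rank_sum Ut Yt"
    unfolding dlr_step_def by blast
  from step have ub: "ub \<in> Vh" and U: "\<And>j. U j \<in> Vh" and ub': "ub' \<in> Vh"
    and on: "\<And>i j. inner_rho lam (Y i) (Y j) = (if i = j then 1 else 0)"
    and mean: "\<And>j. expect lam (Y j) = 0"
    unfolding dlr_step_def dlr_factors_def by blast+
  define D where "D = low_rank_sum Ut (\<lambda>j \<omega>. (Yt j \<omega> - Y j \<omega>) / dt)"
  note D_props = stochastic_increment[OF inj pos sum1 on mean stoch D_def]
  define a where "a = ub' - ub"
  define b where "b j = Ut j - U j" for j
  \<comment> \<open>Splitting \<open>Yt\<close> into \<open>Y\<close> plus \<open>dt\<close> times
    its difference quotient keeps the old stochastic basis and collects the rest in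
    \<open>D\<close>.\<close>
  have u'_eq: "u' \<omega> = ub' + low_rank_sum Ut Y \<omega> + dt *\<^sub>R D \<omega>" for \<omega>
    using dt by (simp add: u' reorth) (simp add: D_def low_rank_sum_def scaleR_sum_right
        scaleR_diff_left sum_subtractf)
  have incr_eq: "u' \<omega> - u \<omega> = a + low_rank_sum b Y \<omega> + dt *\<^sub>R D \<omega>" for \<omega>
    by (simp add: u'_eq u a_def b_def low_rank_sum_def scaleR_diff_right sum_subtractf)
  \<comment> \<open>The mean and the \<open>Y k\<close>-moments of the increment recover
    \<open>a\<close> and \<open>b k\<close>: \<open>D\<close> contributes nothing, and the
    \<open>Y j\<close> are centred and orthonormal.\<close>
  have incr_mean: "expect lam (\<lambda>\<omega>. u' \<omega> - u \<omega>) = a"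
    by (simp add: incr_eq low_rank_sum_def expect_add expect_const[OF sum1] expect_sum
        expect_scaleR_const expect_scaleR mean D_props)
  have incr_mode: "expect lam (\<lambda>\<omega>. Y k \<omega> *\<^sub>R (u' \<omega> - u \<omega>)) = b k" for k
  proof -
    have dt_D: "expect lam (\<lambda>\<omega>. (Y k \<omega> * dt) *\<^sub>R D \<omega>) = 0"
      using expect_scaleR[of lam dt "\<lambda>\<omega>. Y k \<omega> *\<^sub>R D \<omega>"] D_props(2)[of k]
      by (simp add: mult.commute)
    have "expect lam (\<lambda>\<omega>. Y k \<omega> *\<^sub>R (u' \<omega> - u \<omega>))
        = (\<Sum>j\<in>UNIV. inner_rho lam (Y k) (Y j) *\<^sub>R b j)"
      by (simp add: incr_eq low_rank_sum_def scaleR_add_right expect_add expect_sum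
          expect_scaleR_const expect_scaleR scaleR_sum_right inner_rho_eq_expect mean D_props dt_D)
    also have "\<dots> = b k"
      by (simp add: on if_distrib[of "\<lambda>x. x *\<^sub>R _"] cong: if_cong)
    finally show ?thesis .
  qed
  \<comment> \<open>Apart from its \<open>dt *\<^sub>R D \<omega>\<close> part, the increment is
    paired with \<open>D\<close> only through moments of \<open>D\<close> that vanish.\<close>
  have incr_D: "expect lam (\<lambda>\<omega>. \<iota> (u' \<omega> - u \<omega>) \<bullet> \<iota> (D \<omega>)) = dt * expect lam (\<lambda>\<omega>. \<iota> (D \<omega>) \<bullet> \<iota> (D \<omega>))"
  proof -
    have "\<iota> (u' \<omega> - u \<omega>) \<bullet> \<iota> (D \<omega>) = \<iota> (D \<omega>) \<bullet> \<iota> a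
        + (\<Sum>j\<in>UNIV. \<iota> (Y j \<omega> *\<^sub>R D \<omega>) \<bullet> \<iota> (b j)) + dt * (\<iota> (D \<omega>) \<bullet> \<iota> (D \<omega>))" for \<omega>
      by (simp add: incr_eq low_rank_sum_def blinfun.bilinear_simps blinfun.sum_right
          inner_simps inner_sum_left inner_sum_right inner_commute)
    then have "expect lam (\<lambda>\<omega>. \<iota> (u' \<omega> - u \<omega>) \<bullet> \<iota> (D \<omega>)) = \<iota> (expect lam D) \<bullet> \<iota> a
        + (\<Sum>j\<in>UNIV. \<iota> (expect lam (\<lambda>\<omega>. Y j \<omega> *\<^sub>R D \<omega>)) \<bullet> \<iota> (b j))
        + dt * expect lam (\<lambda>\<omega>. \<iota> (D \<omega>) \<bullet> \<iota> (D \<omega>))"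
      by (simp add: expect_add expect_sum expect_mult_left expect_blinfun_right expect_inner_left)
    then show ?thesis
      by (simp add: D_props blinfun.zero_right)
  qed
  \<comment> \<open>Each part of the test function selects one equation: \<open>c\<close> the mean
    equation, \<open>V j\<close> the \<open>j\<close>-th mode equation, and \<open>D\<close> its own
    energy identity.\<close>
  have galerkin: "expect lam (\<lambda>\<omega>. \<iota> (u' \<omega> - u \<omega>) \<bullet> \<iota> (v \<omega>))
      + dt * expect lam (\<lambda>\<omega>. blinfun_apply (G \<omega>) (v \<omega>)) = 0"
    if c: "c \<in> Vh" and V: "\<And>j. V j \<in> Vh" and v: "\<And>\<omega>. v \<omega> = c + low_rank_sum V Y \<omega> + dt *\<^sub>R D \<omega>"
    for c V v
  proof -
    let ?E = "\<lambda>j. expect lam (\<lambda>\<omega>. Y j \<omega> *\<^sub>R G \<omega>)"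
    have ac: "\<iota> a \<bullet> \<iota> c = - (dt * blinfun_apply (expect lam G) c)"
      using mean_eq[OF c] dt
      by (simp add: a_def[symmetric] blinfun.scaleR_right field_simps)
    have bV: "\<iota> (b j) \<bullet> \<iota> (V j) = - (dt * blinfun_apply (?E j) (V j))" for j
      using mode_eq[OF V, of j j] dt
      by (simp add: b_def[symmetric] blinfun.scaleR_right field_simps)
    have DD: "expect lam (\<lambda>\<omega>. \<iota> (D \<omega>) \<bullet> \<iota> (D \<omega>)) = - expect lam (\<lambda>\<omega>. blinfun_apply (G \<omega>) (D \<omega>))"
      using D_props(3) by linarith
    have "expect lam (\<lambda>\<omega>. \<iota> (u' \<omega> - u \<omega>) \<bullet> \<iota> (v \<omega>)) = \<iota> (expect lam (\<lambda>\<omega>. u' \<omega> - u \<omega>)) \<bullet> \<iota> c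
        + (\<Sum>j\<in>UNIV. \<iota> (expect lam (\<lambda>\<omega>. Y j \<omega> *\<^sub>R (u' \<omega> - u \<omega>))) \<bullet> \<iota> (V j))
        + dt * expect lam (\<lambda>\<omega>. \<iota> (u' \<omega> - u \<omega>) \<bullet> \<iota> (D \<omega>))"
      by (simp add: v low_rank_sum_def blinfun.add_right blinfun.sum_right blinfun.scaleR_right
          inner_add_right inner_sum_right expect_add expect_sum expect_mult_left
          expect_blinfun_right expect_inner_left)
    also have "\<dots> = \<iota> a \<bullet> \<iota> c + (\<Sum>j\<in>UNIV. \<iota> (b j) \<bullet> \<iota> (V j))
        + dt * (dt * expect lam (\<lambda>\<omega>. \<iota> (D \<omega>) \<bullet> \<iota> (D \<omega>)))"
      by (simp only: incr_mean incr_mode incr_D)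
    finally have "expect lam (\<lambda>\<omega>. \<iota> (u' \<omega> - u \<omega>) \<bullet> \<iota> (v \<omega>)) = - (dt *
        (blinfun_apply (expect lam G) c + (\<Sum>j\<in>UNIV. blinfun_apply (?E j) (V j))
         + dt * expect lam (\<lambda>\<omega>. blinfun_apply (G \<omega>) (D \<omega>))))"
      unfolding ac bV DD by (simp add: sum_negf sum_distrib_left algebra_simps)
    moreover have "expect lam (\<lambda>\<omega>. blinfun_apply (G \<omega>) (v \<omega>))
        = blinfun_apply (expect lam G) c + (\<Sum>j\<in>UNIV. blinfun_apply (?E j) (V j))
         + dt * expect lam (\<lambda>\<omega>. blinfun_apply (G \<omega>) (D \<omega>))"
      by (simp add: v low_rank_sum_def blinfun.add_right blinfun.sum_right blinfun.scaleR_right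
          blinfun.scaleR_left expect_add expect_sum expect_mult_left expect_blinfun_left)
    ultimately show ?thesis
      by simp
  qed
  \<comment> \<open>The new iterate has \<open>c = ub'\<close> and \<open>V = Ut\<close>, the
    predicted modes on the old basis; the increment has \<open>c = a\<close> and
    \<open>V = b\<close>, differences inside \<open>Vh\<close>.\<close>
  from w show ?thesis
  proof
    assume "w = u'"
    then show ?thesis
      by (intro galerkin[of ub' Ut]) (simp_all add: ub' Ut u'_eq)
  next
    assume w: "w = (\<lambda>\<omega>. u' \<omega> - u \<omega>)"
    show ?thesis
      by (intro galerkin[of a b])
        (simp_all add: w incr_eq a_def b_def subspace_diff[OF sub] ub ub' U Ut)
  qed
qed

section \<open>Energy estimates for one implicit step\<close>

lemma sum_telescope_le:
  fixes a b :: "nat \<Rightarrow> real"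
  assumes "\<And>n. n < N \<Longrightarrow> e (Suc n) + a n \<le> e n + b n"
  shows "e N + (\<Sum>n<N. a n) \<le> e 0 + (\<Sum>n<N. b n)"
  using assms
proof (induction N)
  case (Suc N)
  then show ?case
    using Suc.prems[of N] by fastforce
qed simp

lemma young_inequality:
  fixes x y c :: real
  assumes "c > 0"
  shows "2 * (x * y) \<le> x\<^sup>2 / c + c * y\<^sup>2"
proof -
  have "0 \<le> (x - c * y)\<^sup>2 / c"
    using assms by simp
  also have "\<dots> = x\<^sup>2 / c + c * y\<^sup>2 - 2 * (x * y)"
    using assms by (simp add: power2_eq_square field_simps)
  finally show ?thesis by simp
qed

text \<open>The new iterate is the test function. The integrands are compared for each
  \<open>\<omega>\<close> with twice the tested integrand, whose expectation is 0 by
  \<open>gal\<close>. Since the operator is evaluated at \<open>u'\<close>, coercivity applies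
  directly and no bound on \<open>dt\<close> arises.\<close>

lemma implicit_step_energy_H:
  fixes \<iota> :: "'v::real_inner \<Rightarrow>\<^sub>L 'h::real_inner"
    and lam :: "'w::finite \<Rightarrow> real"
  assumes pos: "\<And>\<omega>. lam \<omega> > 0" and dt: "dt > 0"
    and CP: "\<And>v. norm (\<iota> v) \<le> CP * norm v"
    and ell: "elliptic_operator L CL CB"
    and gal: "expect lam (\<lambda>\<omega>. \<iota> (u' \<omega> - u \<omega>) \<bullet> \<iota> (u' \<omega>))
      + dt * expect lam (\<lambda>\<omega>. blinfun_apply (L \<omega> (u' \<omega>) - to_dual \<iota> (g \<omega>)) (u' \<omega>)) = 0"
  shows "(norm_rho_H \<iota> lam u')\<^sup>2 + dt * CL * (norm_rho lam u')\<^sup>2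
    \<le> (norm_rho_H \<iota> lam u)\<^sup>2 + dt * (CP\<^sup>2 / CL) * (norm_rho lam g)\<^sup>2"
proof -
  have CL: "CL > 0" and coer: "\<And>\<omega> v. blinfun_apply (L \<omega> v) v \<ge> CL * (norm v)\<^sup>2"
    using ell by (auto simp: elliptic_operator_def)
  have "(norm (\<iota> (u' \<omega>)))\<^sup>2 + dt * CL * (norm (u' \<omega>))\<^sup>2
      - ((norm (\<iota> (u \<omega>)))\<^sup>2 + dt * (CP\<^sup>2 / CL) * (norm (g \<omega>))\<^sup>2)
      \<le> 2 * (\<iota> (u' \<omega> - u \<omega>) \<bullet> \<iota> (u' \<omega>)
        + dt * blinfun_apply (L \<omega> (u' \<omega>) - to_dual \<iota> (g \<omega>)) (u' \<omega>))" (is "?l \<le> ?r") for \<omega>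
  proof -
    \<comment> \<open>Young's inequality is weighted by \<open>CL\<close>: twice coercivity provides
      \<open>2 * CL * (norm (u' \<omega>))\<^sup>2\<close>, of which one half absorbs the forcing
      and the other remains in the estimate.\<close>
    have "2 * (g \<omega> \<bullet> \<iota> (u' \<omega>)) \<le> 2 * (norm (g \<omega>) * norm (\<iota> (u' \<omega>)))"
      using norm_cauchy_schwarz[of "g \<omega>" "\<iota> (u' \<omega>)"] by simp
    also have "\<dots> \<le> 2 * (norm (g \<omega>) * (CP * norm (u' \<omega>)))"
      using CP[of "u' \<omega>"] by (simp add: mult_left_mono)
    also have "\<dots> = 2 * ((CP * norm (g \<omega>)) * norm (u' \<omega>))"
      by simp
    also have "\<dots> \<le> (CP * norm (g \<omega>))\<^sup>2 / CL + CL * (norm (u' \<omega>))\<^sup>2"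
      by (rule young_inequality[OF CL])
    finally have *: "2 * blinfun_apply (L \<omega> (u' \<omega>) - to_dual \<iota> (g \<omega>)) (u' \<omega>)
        \<ge> CL * (norm (u' \<omega>))\<^sup>2 - CP\<^sup>2 / CL * (norm (g \<omega>))\<^sup>2"
      using coer[of "u' \<omega>" \<omega>]
      by (simp add: to_dual_def blinfun.diff_left power_mult_distrib inner_commute)
    \<comment> \<open>This is the polarization identity after dropping the squared H-norm of the
      increment.\<close>
    have "(norm (\<iota> (u' \<omega>)))\<^sup>2 - (norm (\<iota> (u \<omega>)))\<^sup>2 \<le> 2 * (\<iota> (u' \<omega> - u \<omega>) \<bullet> \<iota> (u' \<omega>))"
      using inner_ge_zero[of "\<iota> (u' \<omega>) - \<iota> (u \<omega>)"]
      by (simp add: power2_norm_eq_inner blinfun.diff_right inner_diff inner_commute)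
    with mult_left_mono[OF *, of dt] dt show ?thesis
      by (simp add: algebra_simps)
  qed
  then have "expect lam (\<lambda>\<omega>. (norm (\<iota> (u' \<omega>)))\<^sup>2 + dt * CL * (norm (u' \<omega>))\<^sup>2
      - ((norm (\<iota> (u \<omega>)))\<^sup>2 + dt * (CP\<^sup>2 / CL) * (norm (g \<omega>))\<^sup>2))
      \<le> expect lam (\<lambda>\<omega>. 2 * (\<iota> (u' \<omega> - u \<omega>) \<bullet> \<iota> (u' \<omega>)
        + dt * blinfun_apply (L \<omega> (u' \<omega>) - to_dual \<iota> (g \<omega>)) (u' \<omega>)))"
    by (intro expect_mono pos)
  then show ?thesis
    unfolding norm_rho_H_def norm_rho_square[of lam, OF pos]
    using gal by (simp only: expect_add expect_diff expect_mult_left)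
qed

text \<open>The increment is the test function, and symmetry turns the operator term into a
  difference of energies. The factor \<open>2 / dt\<close> on the tested integrand produces two
  copies of \<open>(norm (\<iota> d))\<^sup>2 / dt\<close>: one absorbs the forcing by Young's
  inequality, the other is the difference quotient term.\<close>

lemma implicit_step_energy_L:
  fixes \<iota> :: "'v::real_inner \<Rightarrow>\<^sub>L 'h::real_inner"
    and lam :: "'w::finite \<Rightarrow> real"
  assumes pos: "\<And>\<omega>. lam \<omega> > 0" and dt: "dt > 0"
    and ell: "elliptic_operator L CL CB" and sym: "symmetric_operator L"
    and gal: "expect lam (\<lambda>\<omega>. \<iota> (u' \<omega> - u \<omega>) \<bullet> \<iota> (u' \<omega> - u \<omega>))
      + dt * expect lam (\<lambda>\<omega>. blinfun_apply (L \<omega> (u' \<omega>) - to_dual \<iota> (g \<omega>)) (u' \<omega> - u \<omega>)) = 0"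
  shows "(norm_L lam L u')\<^sup>2 + dt * (norm_rho_H \<iota> lam (\<lambda>\<omega>. (u' \<omega> - u \<omega>) /\<^sub>R dt))\<^sup>2
    \<le> (norm_L lam L u)\<^sup>2 + dt * (norm_rho lam g)\<^sup>2"
proof -
  have lin: "\<And>\<omega>. linear (L \<omega>)"
    using ell by (auto simp: elliptic_operator_def)
  have "blinfun_apply (L \<omega> (u' \<omega>)) (u' \<omega>) + dt * (norm (\<iota> ((u' \<omega> - u \<omega>) /\<^sub>R dt)))\<^sup>2
      - (blinfun_apply (L \<omega> (u \<omega>)) (u \<omega>) + dt * (norm (g \<omega>))\<^sup>2)
      \<le> (2 / dt) * (\<iota> (u' \<omega> - u \<omega>) \<bullet> \<iota> (u' \<omega> - u \<omega>)
        + dt * blinfun_apply (L \<omega> (u' \<omega>) - to_dual \<iota> (g \<omega>)) (u' \<omega> - u \<omega>))" (is "?l \<le> ?r") for \<omega>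
  proof -
    define d where "d = u' \<omega> - u \<omega>"
    have "2 * (g \<omega> \<bullet> \<iota> d) \<le> 2 * (norm (\<iota> d) * norm (g \<omega>))"
      using norm_cauchy_schwarz[of "g \<omega>" "\<iota> d"] by (simp add: mult.commute)
    also have "\<dots> \<le> (norm (\<iota> d))\<^sup>2 / dt + dt * (norm (g \<omega>))\<^sup>2"
      by (rule young_inequality[OF dt])
    finally have 1: "2 * (g \<omega> \<bullet> \<iota> d) \<le> (norm (\<iota> d))\<^sup>2 / dt + dt * (norm (g \<omega>))\<^sup>2" .
    \<comment> \<open>By symmetry the two sides differ by the value of \<open>L \<omega> d\<close>
      at \<open>d\<close>, which is nonnegative.\<close>
    have 2: "blinfun_apply (L \<omega> (u' \<omega>)) (u' \<omega>) - blinfun_apply (L \<omega> (u \<omega>)) (u \<omega>)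
        \<le> 2 * blinfun_apply (L \<omega> (u' \<omega>)) d"
      using elliptic_operator_nonneg[OF ell, of \<omega> d] sym
      by (simp add: d_def symmetric_operator_def linear_diff[OF lin] blinfun.diff_left
          blinfun.diff_right)
    have 3: "dt * (norm (\<iota> (d /\<^sub>R dt)))\<^sup>2 = (norm (\<iota> d))\<^sup>2 / dt"
      using dt by (simp add: blinfun.scaleR_right power_mult_distrib power2_eq_square field_simps)
    have "(2 / dt) * (\<iota> d \<bullet> \<iota> d + dt * blinfun_apply (L \<omega> (u' \<omega>) - to_dual \<iota> (g \<omega>)) d)
        = 2 * ((norm (\<iota> d))\<^sup>2 / dt) + 2 * blinfun_apply (L \<omega> (u' \<omega>)) d - 2 * (g \<omega> \<bullet> \<iota> d)"
      using dt by (simp add: to_dual_def blinfun.diff_left power2_norm_eq_inner field_simps inner_commute)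
    with 1 2 3 show ?thesis
      unfolding d_def[symmetric] by linarith
  qed
  then have "expect lam (\<lambda>\<omega>. blinfun_apply (L \<omega> (u' \<omega>)) (u' \<omega>)
      + dt * (norm (\<iota> ((u' \<omega> - u \<omega>) /\<^sub>R dt)))\<^sup>2
      - (blinfun_apply (L \<omega> (u \<omega>)) (u \<omega>) + dt * (norm (g \<omega>))\<^sup>2))
      \<le> expect lam (\<lambda>\<omega>. (2 / dt) * (\<iota> (u' \<omega> - u \<omega>) \<bullet> \<iota> (u' \<omega> - u \<omega>)
        + dt * blinfun_apply (L \<omega> (u' \<omega>) - to_dual \<iota> (g \<omega>)) (u' \<omega> - u \<omega>)))"
    by (intro expect_mono pos)
  then show ?thesis
    unfolding norm_rho_H_def norm_rho_square[of lam, OF pos] norm_L_square[of lam, OF pos ell]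
    using gal by (simp only: expect_add expect_diff expect_mult_left)
qed

section \<open>Stability over all time steps\<close>

theorem theorem5p4:
  fixes \<iota> :: "'v::{real_inner, complete_space} \<Rightarrow>\<^sub>L 'h::{real_inner, complete_space}"
    and lam :: "'w::finite \<Rightarrow> real"
    and L :: "'w \<Rightarrow> 'v \<Rightarrow> ('v \<Rightarrow>\<^sub>L real)"
    and CP CL CB T dt h :: real
    and Vh :: "real \<Rightarrow> 'v set"
    and f :: "real \<Rightarrow> 'w \<Rightarrow> 'h"
    and N :: nat
    and ub :: "nat \<Rightarrow> 'v"
    and U :: "nat \<Rightarrow> 'r::finite \<Rightarrow> 'v"
    and Y :: "nat \<Rightarrow> 'r \<Rightarrow> 'w \<Rightarrow> real"
    and u :: "nat \<Rightarrow> 'w \<Rightarrow> 'v"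
  assumes "gelfand_triple \<iota> CP"
    and "\<And>\<omega>. lam \<omega> > 0" and "(\<Sum>\<omega>\<in>UNIV. lam \<omega>) = 1"
    and "elliptic_operator L CL CB"
    and "h > 0"
    and "subspace (Vh h)" and "\<exists>B. finite B \<and> Vh h = span B"
    and "dim (Vh h) > CARD('r)" and "CARD('r) < CARD('w)"
    and "T > 0" and "N \<ge> 1" and "dt = T / real N"
    and "implicit_dlr_solution \<iota> lam L (Vh h) f dt N ub U Y u"
  shows
    "(norm_rho_H \<iota> lam (u N))\<^sup>2 + dt * CL * (\<Sum>n<N. (norm_rho lam (u (n+1)))\<^sup>2)
       \<le> (norm_rho_H \<iota> lam (u 0))\<^sup>2
         + dt * (CP\<^sup>2 / CL) * (\<Sum>n<N. (norm_rho lam (f (real (n+1) * dt)))\<^sup>2)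
     \<and> (symmetric_operator L \<longrightarrow>
       (norm_L lam L (u N))\<^sup>2
         + dt * (\<Sum>n<N. (norm_rho_H \<iota> lam (\<lambda>\<omega>. (u (n+1) \<omega> - u n \<omega>) /\<^sub>R dt))\<^sup>2)
       \<le> (norm_L lam L (u 0))\<^sup>2
         + dt * (\<Sum>n<N. (norm_rho lam (f (real (n+1) * dt)))\<^sup>2))
     \<and> ((\<forall>m\<le>N. f (real m * dt) = (\<lambda>\<omega>. 0)) \<longrightarrow>
       (\<forall>n<N. norm_rho_H \<iota> lam (u (n+1)) \<le> norm_rho_H \<iota> lam (u n)) \<and>
       (symmetric_operator L \<longrightarrow> (\<forall>n<N. norm_L lam L (u (n+1)) \<le> norm_L lam L (u n))))"
proof -
  have pos: "\<And>\<omega>. lam \<omega> > 0" and ell: "elliptic_operator L CL CB"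
    using assms by blast+
  have inj: "inj (blinfun_apply \<iota>)" and CP: "\<And>v. norm (\<iota> v) \<le> CP * norm v"
    using assms(1) by (auto simp: gelfand_triple_def)
  \<comment> \<open>\<open>N \<ge> 1\<close> matters: for \<open>N = 0\<close> the quotient
    \<open>T / real N\<close> would be 0.\<close>
  have dt: "dt > 0" and CL: "CL > 0"
    using assms by (auto simp: elliptic_operator_def)
  let ?f = "\<lambda>n. f (real (n + 1) * dt)"
  \<comment> \<open>The new iterate occurs inside \<open>G\<close>; the Galerkin identity holds for
    every \<open>G\<close>, so this coupling does no harm.\<close>
  have gal: "expect lam (\<lambda>\<omega>. \<iota> (u (n+1) \<omega> - u n \<omega>) \<bullet> \<iota> (w \<omega>))
      + dt * expect lam (\<lambda>\<omega>. blinfun_apply (L \<omega> (u (n+1) \<omega>) - to_dual \<iota> (?f n \<omega>)) (w \<omega>)) = 0"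
    if "n < N" and w: "w = u (n+1) \<or> w = (\<lambda>\<omega>. u (n+1) \<omega> - u n \<omega>)" for n w
  proof (rule dlr_step_galerkin[OF inj pos assms(3) dt assms(6) _ _ _ w])
    show "dlr_step \<iota> lam (Vh h) dt (\<lambda>\<omega>. L \<omega> (u (n+1) \<omega>) - to_dual \<iota> (?f n \<omega>))
        (ub n) (U n) (Y n) (ub (n+1)) (U (n+1)) (Y (n+1))"
      using assms(13) \<open>n < N\<close> unfolding implicit_dlr_solution_def by blast
    have "u m = (\<lambda>\<omega>. ub m + low_rank_sum (U m) (Y m) \<omega>)" if "m \<le> N" for m
      using assms(13) that unfolding implicit_dlr_solution_def by blast
    then show "u n = (\<lambda>\<omega>. ub n + low_rank_sum (U n) (Y n) \<omega>)"
      "u (n+1) = (\<lambda>\<omega>. ub (n+1) + low_rank_sum (U (n+1)) (Y (n+1)) \<omega>)"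
      using \<open>n < N\<close> by simp_all
  qed
  have H: "(norm_rho_H \<iota> lam (u (n+1)))\<^sup>2 + dt * CL * (norm_rho lam (u (n+1)))\<^sup>2
      \<le> (norm_rho_H \<iota> lam (u n))\<^sup>2 + dt * (CP\<^sup>2 / CL) * (norm_rho lam (?f n))\<^sup>2" if "n < N" for n
    using gal[OF that] by (intro implicit_step_energy_H[OF pos dt CP ell]) simp
  have E: "(norm_L lam L (u (n+1)))\<^sup>2
      + dt * (norm_rho_H \<iota> lam (\<lambda>\<omega>. (u (n+1) \<omega> - u n \<omega>) /\<^sub>R dt))\<^sup>2
      \<le> (norm_L lam L (u n))\<^sup>2 + dt * (norm_rho lam (?f n))\<^sup>2"
    if "symmetric_operator L" "n < N" for n
    using gal[OF that(2)] by (intro implicit_step_energy_L[OF pos dt ell that(1)]) simp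
  show ?thesis
  proof (intro conjI impI allI)
    show "(norm_rho_H \<iota> lam (u N))\<^sup>2 + dt * CL * (\<Sum>n<N. (norm_rho lam (u (n+1)))\<^sup>2)
       \<le> (norm_rho_H \<iota> lam (u 0))\<^sup>2 + dt * (CP\<^sup>2 / CL) * (\<Sum>n<N. (norm_rho lam (?f n))\<^sup>2)"
      unfolding sum_distrib_left
      using H by (intro sum_telescope_le[where e = "\<lambda>n. (norm_rho_H \<iota> lam (u n))\<^sup>2"]) simp
  next
    assume sym: "symmetric_operator L"
    show "(norm_L lam L (u N))\<^sup>2
         + dt * (\<Sum>n<N. (norm_rho_H \<iota> lam (\<lambda>\<omega>. (u (n+1) \<omega> - u n \<omega>) /\<^sub>R dt))\<^sup>2)
       \<le> (norm_L lam L (u 0))\<^sup>2 + dt * (\<Sum>n<N. (norm_rho lam (?f n))\<^sup>2)"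
      unfolding sum_distrib_left
      using E[OF sym] by (intro sum_telescope_le[where e = "\<lambda>n. (norm_L lam L (u n))\<^sup>2"]) simp
  next
    fix n
    assume f0: "\<forall>m\<le>N. f (real m * dt) = (\<lambda>\<omega>. 0)" and n: "n < N"
    \<comment> \<open>The forcing of step \<open>n\<close> sits at node \<open>n + 1\<close>, which
      is at most \<open>N\<close> because \<open>n < N\<close>.\<close>
    have f0n: "norm_rho lam (?f n) = 0"
      using f0[rule_format, of "n + 1"] n by (simp add: norm_rho_def inner_rho_def)
    \<comment> \<open>Without forcing, dropping the nonnegative dissipation compares squares, and
      nonnegativity of the norm of \<open>u n\<close> permits taking roots.\<close>
    have "0 \<le> dt * CL * (norm_rho lam (u (n+1)))\<^sup>2"
      using dt CL by simp
    then have "(norm_rho_H \<iota> lam (u (n+1)))\<^sup>2 \<le> (norm_rho_H \<iota> lam (u n))\<^sup>2"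
      using H[OF n] unfolding f0n by simp
    then show "norm_rho_H \<iota> lam (u (n+1)) \<le> norm_rho_H \<iota> lam (u n)"
      by (rule power2_le_imp_le) (simp add: norm_rho_H_def norm_rho_def inner_rho_nonneg[of lam, OF pos])
    assume sym: "symmetric_operator L"
    have "0 \<le> dt * (norm_rho_H \<iota> lam (\<lambda>\<omega>. (u (n+1) \<omega> - u n \<omega>) /\<^sub>R dt))\<^sup>2"
      using dt by simp
    then have "(norm_L lam L (u (n+1)))\<^sup>2 \<le> (norm_L lam L (u n))\<^sup>2"
      using E[OF sym n] unfolding f0n by simp
    then show "norm_L lam L (u (n+1)) \<le> norm_L lam L (u n)"
      by (rule power2_le_imp_le) (simp add: norm_L_def inner_L_nonneg[of lam, OF pos ell])
  qed
qed

end
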